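(* Let $\omega:[0,\infty)\to[0,\infty)$ be a non-decreasing continuous function such that $\omega(t)=0$ implies $t=0$. Assume that $y:[0,\infty)\to[0,\infty)$ is a continuous function satisfying $$\int_0^\infty\omega(y(t))\,dt<\infty$$ and $$y(t)-y(s)\le\int_s^t\big[g(\xi)\varphi(y(\xi))+h(\xi)\big]\,d\xi,\qquad 0\le s\le t,$$ where $g$ and $h$ are nonnegative locally integrable functions on $[0,\infty)$, $\varphi\ge 0$ is a continuous function on $[0,\infty)$, and the functions $t\mapsto\int_0^t g(x)\,dx$ and $t\mapsto\int_0^t h(x)\,dx$ are uniformly continuous on $[0,\infty)$. Then $$\lim_{t\to\infty}y(t)=0.$$ *)

theory Defs
  imports "HOL-Analysis.Analysis"
begin

text \<open>Local integrability on \<open>S\<close> is Lebesgue integrability on every compact subset of \<open>S\<close>;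
  for \<open>S = [0,\<infinity>)\<close> the compact sets may contain the endpoint \<open>0\<close>.\<close>

definition locally_integrable_on :: "('a::euclidean_space \<Rightarrow> real) \<Rightarrow> 'a set \<Rightarrow> bool"
    (infixr "locally'_integrable'_on" 46)
  where "f locally_integrable_on S \<longleftrightarrow>
    (\<forall>K. compact K \<and> K \<subseteq> S \<longrightarrow> set_integrable lebesgue K f)"

end

theory Submission
  imports Defs
begin

text \<open>
  The integral condition makes \<open>y\<close> small in the mean, but by itself it allows tall spikes of
  vanishing width. The increment inequality excludes them, because it prevents \<open>y\<close> from rising
  quickly. Fix \<open>\<epsilon> > 0\<close> and suppose that \<open>y t \<ge> 2 * \<epsilon>\<close> while \<open>y s < \<epsilon>\<close> at some earlier time \<open>s\<close>. Up to
  the first time \<open>r\<close> after \<open>s\<close> with \<open>y r = 2 * \<epsilon>\<close> the values of \<open>y\<close> stay in \<open>[0, 2 * \<epsilon>]\<close>, where the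
  continuous function \<open>\<phi>\<close> is bounded by some \<open>M\<close>, so
  \<open>\<epsilon> < y r - y s \<le> M * \<integral>g + \<integral>h\<close> with both integrals over \<open>[s, r]\<close>. Uniform continuity of the
  primitives of \<open>g\<close> and \<open>h\<close> makes the right-hand side smaller than \<open>\<epsilon>\<close> as soon as \<open>t - s < \<delta>\<close>, for
  some \<open>\<delta>\<close> independent of the position of \<open>s\<close> and \<open>t\<close>. Hence \<open>y \<ge> \<epsilon>\<close> on a window of fixed length
  before every \<open>t\<close> with \<open>y t \<ge> 2 * \<epsilon>\<close> (\<open>stays_above_on_uniform_window\<close>).

  On the window \<open>[t - \<delta> / 2, t]\<close> the monotone function \<open>\<omega>\<close> satisfies \<open>\<omega> (y s) \<ge> \<omega> \<epsilon> > 0\<close>, so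
  \<open>\<omega> \<circ> y\<close> has integral at least \<open>\<omega> \<epsilon> * (\<delta> / 2)\<close> there. Since the tails of its finite integral tend
  to zero (\<open>nn_integral_tail_small\<close>), this is impossible for large \<open>t\<close>, that is, \<open>y t < 2 * \<epsilon>\<close>
  eventually.
\<close>

lemma first_hitting_time:
  fixes f :: "real \<Rightarrow> real"
  assumes cont: "continuous_on {a..b} f" and "a \<le> b" and below: "f a \<le> c" and above: "c \<le> f b"
  obtains r where "r \<in> {a..b}" "f r = c" "\<And>x. x \<in> {a..r} \<Longrightarrow> f x \<le> c"
proof -
  define S where "S = {a..b} \<inter> f -` {c}"
  have "compact S"
    unfolding S_def compact_eq_bounded_closed
    using continuous_closed_preimage[OF cont, of "{c}"] by (auto intro: bounded_subset)
  moreover have "S \<noteq> {}"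
    using IVT'[of f a c b, OF below above \<open>a \<le> b\<close> cont] by (auto simp: S_def)
  ultimately obtain r where r: "r \<in> S" and first: "\<And>x. x \<in> S \<Longrightarrow> r \<le> x"
    using compact_attains_inf by metis
  show thesis
  proof
    show "r \<in> {a..b}" "f r = c"
      using r by (auto simp: S_def)
    fix x assume x: "x \<in> {a..r}"
    show "f x \<le> c"
    proof (rule ccontr)
      assume gt: "\<not> f x \<le> c"
      have "continuous_on {a..x} f"
        using cont by (rule continuous_on_subset) (use x r in \<open>auto simp: S_def\<close>)
      then obtain u where u: "a \<le> u" "u \<le> x" "f u = c"
        using IVT'[of f a c x, OF below] gt x by auto
      then have "r \<le> u"
        using first x r by (auto simp: S_def)
      then show False
        using u x gt by (metis atLeastAtMost_iff order.trans order.antisym order.refl)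
    qed
  qed
qed

text \<open>
  The function is the density of a measure that is finite on the half-line, and such a measure is
  continuous from above along the sets \<open>{n..}\<close>, whose intersection is empty.
\<close>

lemma nn_integral_tail_small:
  fixes f :: "real \<Rightarrow> ennreal"
  assumes meas: "(\<lambda>t. f t * indicator {0..} t) \<in> borel_measurable lebesgue"
    and fin: "(\<integral>\<^sup>+ t\<in>{0..}. f t \<partial>lebesgue) < \<infinity>" and "e > 0"
  obtains N :: nat where "(\<integral>\<^sup>+ t\<in>{real N..}. f t \<partial>lebesgue) < e"
proof -
  define F where "F t = f t * indicator {0..} t" for t
  define D where "D = density lebesgue F"
  have [measurable]: "F \<in> borel_measurable lebesgue"
    using meas by (simp add: F_def[abs_def])
  have D: "emeasure D {real n..} = (\<integral>\<^sup>+ t\<in>{real n..}. f t \<partial>lebesgue)" for n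
    unfolding D_def
    by (subst emeasure_density) (auto simp: F_def intro!: nn_integral_cong split: split_indicator)
  have "emeasure D {real n..} < \<infinity>" for n
    unfolding D by (rule le_less_trans[OF nn_integral_mono fin]) (auto split: split_indicator)
  then have "(\<lambda>n. emeasure D {real n..}) \<longlonglongrightarrow> emeasure D (\<Inter>n. {real n..})"
    by (intro Lim_emeasure_decseq) (auto simp: D_def decseq_def less_top[symmetric])
  moreover have "(\<Inter>n. {real n..}) = {}"
  proof safe
    fix x assume "x \<in> (\<Inter>n. {real n..})"
    then show "x \<in> {}"
      using reals_Archimedean2[of x] by (force simp: not_le[symmetric])
  qed
  ultimately have "eventually (\<lambda>n. emeasure D {real n..} < e) sequentially"
    using \<open>e > 0\<close> by (intro order_tendstoD) auto
  then show thesis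
    using that D by (auto simp: eventually_sequentially)
qed

lemma locally_integrable_on_atLeastD:
  fixes f :: "real \<Rightarrow> real"
  assumes "f locally_integrable_on {0..}" "0 \<le> s"
  shows "set_integrable lebesgue {s..t} f"
proof -
  have "compact {s..t}" "{s..t} \<subseteq> {0..}"
    using \<open>0 \<le> s\<close> by auto
  then show ?thesis
    using assms(1) unfolding locally_integrable_on_def by blast
qed

lemma set_integral_Icc_eq_diff:
  fixes f :: "real \<Rightarrow> real"
  assumes f: "f locally_integrable_on {0..}" and "0 \<le> s" "s \<le> t"
  shows "(LINT x:{s..t}|lebesgue. f x) = (LINT x:{0..t}|lebesgue. f x) - (LINT x:{0..s}|lebesgue. f x)"
proof -
  have "AE x in lebesgue. \<not> (x \<in> {0..s} \<and> x \<in> {s..t})"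
    by (rule AE_I'[of "{s}"]) auto
  then have "(LINT x:{0..s} \<union> {s..t}|lebesgue. f x) =
      (LINT x:{0..s}|lebesgue. f x) + (LINT x:{s..t}|lebesgue. f x)"
    using assms by (intro set_integral_Un_AE locally_integrable_on_atLeastD) auto
  moreover have "{0..s} \<union> {s..t} = {0..t}"
    using assms by auto
  ultimately show ?thesis by simp
qed

text \<open>
  The bound \<open>d\<close> depends on the length of the interval only, not on its position; this
  is the form in which uniform continuity of a primitive enters the rate estimate for \<open>y\<close>.
\<close>

lemma set_integral_short_interval_small:
  fixes f :: "real \<Rightarrow> real"
  assumes f: "f locally_integrable_on {0..}"
    and unif: "uniformly_continuous_on {0..} (\<lambda>t. LINT x:{0..t}|lebesgue. f x)"
    and "e > 0"
  obtains d where "d > 0"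
    "\<And>s t. 0 \<le> s \<Longrightarrow> s \<le> t \<Longrightarrow> t - s < d \<Longrightarrow> (LINT x:{s..t}|lebesgue. f x) < e"
proof -
  define F where "F t = (LINT x:{0..t}|lebesgue. f x)" for t
  have "uniformly_continuous_on {0..} F"
    using unif unfolding F_def .
  then obtain d where d: "d > 0"
    "\<And>s t. s \<in> {0..} \<Longrightarrow> t \<in> {0..} \<Longrightarrow> dist t s < d \<Longrightarrow> dist (F t) (F s) < e"
    using \<open>e > 0\<close> unfolding uniformly_continuous_on_def by blast
  show thesis
  proof
    fix s t :: real assume st: "0 \<le> s" "s \<le> t" "t - s < d"
    then have "F t - F s < e"
      using d(2)[of s t] by (simp add: dist_real_def)
    then show "(LINT x:{s..t}|lebesgue. f x) < e"
      unfolding set_integral_Icc_eq_diff[OF f st(1,2)] F_def .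
  qed (fact d)
qed

lemma weighted_set_integral_le:
  fixes g h k :: "'a \<Rightarrow> real"
  assumes g: "set_integrable \<mu> A g" and h: "set_integrable \<mu> A h"
    and g_nonneg: "\<And>x. x \<in> A \<Longrightarrow> 0 \<le> g x" and h_nonneg: "\<And>x. x \<in> A \<Longrightarrow> 0 \<le> h x"
    and k: "\<And>x. x \<in> A \<Longrightarrow> k x \<le> M" and "0 \<le> M"
  shows "(LINT x:A|\<mu>. g x * k x + h x) \<le>
    M * (LINT x:A|\<mu>. g x) + (LINT x:A|\<mu>. h x)"
proof -
  have Mg: "set_integrable \<mu> A (\<lambda>x. M * g x)"
    by (rule set_integrable_mult_right) (rule g)
  have int: "set_integrable \<mu> A (\<lambda>x. M * g x + h x)"
    using set_integral_add(1)[OF Mg h] .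
  have "(LINT x:A|\<mu>. g x * k x + h x) \<le> (LINT x:A|\<mu>. M * g x + h x)"
    unfolding set_lebesgue_integral_def
    \<comment> \<open>This comparison rule asks for integrability of the dominating side only; a non-integrable
      left-hand side has integral \<open>0\<close>, which nonnegativity of the right-hand side covers.\<close>
  proof (rule integral_mono')
    show "integrable \<mu> (\<lambda>x. indicator A x *\<^sub>R (M * g x + h x))"
      using int by (simp add: set_integrable_def)
  next
    fix x
    have "g x * k x \<le> M * g x" "0 \<le> M * g x" "0 \<le> h x" if "x \<in> A"
      using mult_left_mono[OF k[OF that] g_nonneg[OF that]] g_nonneg[OF that] h_nonneg[OF that] \<open>0 \<le> M\<close>
      by (simp_all add: mult.commute[of "g x" M])
    then show "indicator A x *\<^sub>R (g x * k x + h x) \<le> indicator A x *\<^sub>R (M * g x + h x)"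
      and "0 \<le> indicator A x *\<^sub>R (M * g x + h x)"
      by (simp_all split: split_indicator)
  qed
  also have "\<dots> = M * (LINT x:A|\<mu>. g x) + (LINT x:A|\<mu>. h x)"
    using set_integral_add(2)[OF Mg h] by simp
  finally show ?thesis .
qed

text \<open>
  High values of \<open>y\<close> cannot be reached suddenly. The increment is estimated only up to the first
  time at which \<open>y\<close> equals \<open>2 * \<epsilon>\<close>, because the bound on \<open>\<phi>\<close> comes from the
  compact interval \<open>[0, 2 * \<epsilon>]\<close> and \<open>y\<close> may leave that interval afterwards.
\<close>

lemma stays_above_on_uniform_window:
  fixes y g h \<phi> :: "real \<Rightarrow> real"
  assumes y_nonneg: "\<And>t. t \<ge> 0 \<Longrightarrow> y t \<ge> 0"
    and y_cont: "continuous_on {0..} y"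
    and y_increment: "\<And>s t. 0 \<le> s \<Longrightarrow> s \<le> t \<Longrightarrow>
      y t - y s \<le> (LINT \<xi>:{s..t}|lebesgue. g \<xi> * \<phi> (y \<xi>) + h \<xi>)"
    and g_nonneg: "\<And>t. t \<ge> 0 \<Longrightarrow> g t \<ge> 0"
    and h_nonneg: "\<And>t. t \<ge> 0 \<Longrightarrow> h t \<ge> 0"
    and g_loc: "g locally_integrable_on {0..}"
    and h_loc: "h locally_integrable_on {0..}"
    and phi_cont: "continuous_on {0..} \<phi>"
    and g_unif: "uniformly_continuous_on {0..} (\<lambda>t. LINT x:{0..t}|lebesgue. g x)"
    and h_unif: "uniformly_continuous_on {0..} (\<lambda>t. LINT x:{0..t}|lebesgue. h x)"
    and "\<epsilon> > 0"
  obtains \<delta> where "\<delta> > 0"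
    "\<And>s t. 0 \<le> s \<Longrightarrow> s \<le> t \<Longrightarrow> t - s < \<delta> \<Longrightarrow> 2 * \<epsilon> \<le> y t \<Longrightarrow> \<epsilon> \<le> y s"
proof -
  have "compact (\<phi> ` {0..2 * \<epsilon>})"
    by (intro compact_continuous_image continuous_on_subset[OF phi_cont]) auto
  then obtain M0 where M0: "\<And>x. x \<in> {0..2 * \<epsilon>} \<Longrightarrow> \<bar>\<phi> x\<bar> \<le> M0"
    using compact_imp_bounded bounded_iff by (metis imageI real_norm_def)
  \<comment> \<open>The maximum keeps the divisor \<open>M\<close> positive when \<open>\<phi>\<close> vanishes on \<open>[0, 2 * \<epsilon>]\<close>.\<close>
  define M where "M = max M0 1"
  have "M > 0" and M: "\<And>x. x \<in> {0..2 * \<epsilon>} \<Longrightarrow> \<phi> x \<le> M"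
    using M0 by (force simp: M_def)+
  obtain dg where dg: "dg > 0"
    "\<And>s t. 0 \<le> s \<Longrightarrow> s \<le> t \<Longrightarrow> t - s < dg \<Longrightarrow> (LINT x:{s..t}|lebesgue. g x) < \<epsilon> / (2 * M)"
    using set_integral_short_interval_small[OF g_loc g_unif, of "\<epsilon> / (2 * M)"] \<open>\<epsilon> > 0\<close> \<open>M > 0\<close>
    by auto
  obtain dh where dh: "dh > 0"
    "\<And>s t. 0 \<le> s \<Longrightarrow> s \<le> t \<Longrightarrow> t - s < dh \<Longrightarrow> (LINT x:{s..t}|lebesgue. h x) < \<epsilon> / 2"
    using set_integral_short_interval_small[OF h_loc h_unif, of "\<epsilon> / 2"] \<open>\<epsilon> > 0\<close> by auto
  show thesis
  proof
    show "min dg dh > 0"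
      using dg(1) dh(1) by simp
    fix s t :: real
    assume st: "0 \<le> s" "s \<le> t" "t - s < min dg dh" and high: "2 * \<epsilon> \<le> y t"
    show "\<epsilon> \<le> y s"
    proof (rule ccontr)
      assume low: "\<not> \<epsilon> \<le> y s"
      have "continuous_on {s..t} y"
        using y_cont by (rule continuous_on_subset) (use st in auto)
      moreover have "y s \<le> 2 * \<epsilon>"
        using low \<open>\<epsilon> > 0\<close> by simp
      ultimately obtain r where r: "r \<in> {s..t}" "y r = 2 * \<epsilon>"
        and before: "\<And>x. x \<in> {s..r} \<Longrightarrow> y x \<le> 2 * \<epsilon>"
        using first_hitting_time[of s t y "2 * \<epsilon>"] st(2) high by blast
      have "y r - y s \<le> (LINT \<xi>:{s..r}|lebesgue. g \<xi> * \<phi> (y \<xi>) + h \<xi>)"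
        using y_increment[of s r] r(1) st by simp
      also have "\<dots> \<le> M * (LINT x:{s..r}|lebesgue. g x) + (LINT x:{s..r}|lebesgue. h x)"
        using \<open>M > 0\<close> st before M y_nonneg g_nonneg h_nonneg
        by (intro weighted_set_integral_le locally_integrable_on_atLeastD g_loc h_loc) auto
      also have "\<dots> < M * (\<epsilon> / (2 * M)) + \<epsilon> / 2"
        using dg(2)[of s r] dh(2)[of s r] r st \<open>M > 0\<close>
        by (intro add_strict_mono mult_strict_left_mono) auto
      also have "\<dots> = \<epsilon>"
        using \<open>M > 0\<close> by simp
      finally show False
        using low r by simp
    qed
  qed
qed

theorem corollary2p3:
  fixes \<omega> y g h \<phi> :: "real \<Rightarrow> real"
  assumes omega_nonneg: "\<And>t. t \<ge> 0 \<Longrightarrow> \<omega> t \<ge> 0"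
    and omega_mono: "mono_on {0..} \<omega>"
    and omega_cont: "continuous_on {0..} \<omega>"
    and omega_zero: "\<And>t. t \<ge> 0 \<Longrightarrow> \<omega> t = 0 \<Longrightarrow> t = 0"
    and y_nonneg: "\<And>t. t \<ge> 0 \<Longrightarrow> y t \<ge> 0"
    and y_cont: "continuous_on {0..} y"
    and omega_y_integral: "(\<integral>\<^sup>+ t\<in>{0..}. ennreal (\<omega> (y t)) \<partial>lebesgue) < \<infinity>"
    and y_increment: "\<And>s t. 0 \<le> s \<Longrightarrow> s \<le> t \<Longrightarrow>
      y t - y s \<le> (LINT \<xi>:{s..t}|lebesgue. g \<xi> * \<phi> (y \<xi>) + h \<xi>)"
    and g_nonneg: "\<And>t. t \<ge> 0 \<Longrightarrow> g t \<ge> 0"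
    and h_nonneg: "\<And>t. t \<ge> 0 \<Longrightarrow> h t \<ge> 0"
    and g_loc: "g locally_integrable_on {0..}"
    and h_loc: "h locally_integrable_on {0..}"
    and phi_nonneg: "\<And>x. x \<ge> 0 \<Longrightarrow> \<phi> x \<ge> 0"
    and phi_cont: "continuous_on {0..} \<phi>"
    and g_unif: "uniformly_continuous_on {0..} (\<lambda>t. LINT x:{0..t}|lebesgue. g x)"
    and h_unif: "uniformly_continuous_on {0..} (\<lambda>t. LINT x:{0..t}|lebesgue. h x)"
  shows "(y \<longlongrightarrow> 0) at_top"
proof (rule tendstoI)
  fix e :: real assume "e > 0"
  \<comment> \<open>Halved so that the threshold \<open>2 * \<epsilon>\<close> of the window lemma is \<open>e\<close>.\<close>
  define \<epsilon> where "\<epsilon> = e / 2"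
  have "\<epsilon> > 0"
    using \<open>e > 0\<close> by (simp add: \<epsilon>_def)
  obtain \<delta> where "\<delta> > 0" and window:
    "\<And>s t. 0 \<le> s \<Longrightarrow> s \<le> t \<Longrightarrow> t - s < \<delta> \<Longrightarrow> 2 * \<epsilon> \<le> y t \<Longrightarrow> \<epsilon> \<le> y s"
    using stays_above_on_uniform_window[OF y_nonneg y_cont y_increment g_nonneg h_nonneg
        g_loc h_loc phi_cont g_unif h_unif \<open>\<epsilon> > 0\<close>] by blast
  have "\<omega> \<epsilon> > 0"
    using omega_nonneg[of \<epsilon>] omega_zero[of \<epsilon>] \<open>\<epsilon> > 0\<close> by force
  have "continuous_on {0..} (\<lambda>t. \<omega> (y t))"
    by (rule continuous_on_compose2[OF omega_cont y_cont]) (use y_nonneg in auto)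
  then have "(\<lambda>t. indicator {0..} t *\<^sub>R \<omega> (y t)) \<in> borel_measurable borel"
    by (intro borel_measurable_continuous_on_indicator) auto
  then have "(\<lambda>t. ennreal (indicator {0..} t *\<^sub>R \<omega> (y t))) \<in> borel_measurable lebesgue"
    by (intro measurable_compose[OF _ measurable_ennreal] measurable_completion) simp
  also have "(\<lambda>t. ennreal (indicator {0..} t *\<^sub>R \<omega> (y t))) =
      (\<lambda>t. ennreal (\<omega> (y t)) * indicator {0..} t)"
    by (auto split: split_indicator)
  finally have meas: "(\<lambda>t. ennreal (\<omega> (y t)) * indicator {0..} t) \<in> borel_measurable lebesgue" .
  obtain N :: nat where N:
    "(\<integral>\<^sup>+ t\<in>{real N..}. ennreal (\<omega> (y t)) \<partial>lebesgue) < ennreal (\<omega> \<epsilon> * (\<delta> / 2))"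
    using nn_integral_tail_small[OF meas omega_y_integral, of "ennreal (\<omega> \<epsilon> * (\<delta> / 2))"]
      \<open>\<omega> \<epsilon> > 0\<close> \<open>\<delta> > 0\<close> by auto
  \<comment> \<open>The window lemma needs a length strictly below \<open>\<delta>\<close>, hence the closed window of length
    \<open>\<delta> / 2\<close>; the offset \<open>\<delta>\<close> keeps that window inside \<open>{N..}\<close>.\<close>
  have "y t < 2 * \<epsilon>" if t: "t \<ge> real N + \<delta>" for t
  proof (rule ccontr)
    assume "\<not> y t < 2 * \<epsilon>"
    then have "\<epsilon> \<le> y s" if "s \<in> {t - \<delta> / 2..t}" for s
      using window[of s t] that t \<open>\<delta> > 0\<close> by auto
    then have above: "\<omega> \<epsilon> \<le> \<omega> (y s)" if "s \<in> {t - \<delta> / 2..t}" for s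
      using that \<open>\<epsilon> > 0\<close> by (intro mono_onD[OF omega_mono]) force+
    have "ennreal (\<omega> \<epsilon> * (\<delta> / 2)) = (\<integral>\<^sup>+ s. ennreal (\<omega> \<epsilon>) * indicator {t - \<delta> / 2..t} s \<partial>lebesgue)"
      using \<open>\<delta> > 0\<close> \<open>\<omega> \<epsilon> > 0\<close> by (simp add: nn_integral_cmult_indicator ennreal_mult[symmetric])
    also have "\<dots> \<le> (\<integral>\<^sup>+ s\<in>{real N..}. ennreal (\<omega> (y s)) \<partial>lebesgue)"
      using t \<open>\<delta> > 0\<close> above
      by (intro nn_integral_mono) (auto split: split_indicator intro!: ennreal_leI)
    finally show False
      using N by simp
  qed
  moreover have "y t \<ge> 0" if "t \<ge> real N + \<delta>" for t
    using that \<open>\<delta> > 0\<close> by (intro y_nonneg) linarith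
  ultimately show "eventually (\<lambda>t. dist (y t) 0 < e) at_top"
    unfolding eventually_at_top_linorder \<epsilon>_def
    by (intro exI[of _ "real N + \<delta>"]) (auto simp: dist_real_def)
qed

end
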